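(* Let $n\ge 3$, $d\ge 1$, let $\delta=\sum_{i=1}^n\varepsilon_i\,dx_i\otimes dx_i$ with $\varepsilon_i=\pm1$ on $\mathbb R^n$, let $(F^d,g_F)$ be a semi-Riemannian manifold with constant scalar curvature $\lambda_F$, let $\alpha\in\mathbb R^n$ be nonzero, $\xi(x)=\sum_i\alpha_ix_i$ and $\|\alpha\|^2=\sum_i\varepsilon_i\alpha_i^2$. For smooth functions $\varphi,f,h:(a,b)\to(0,\infty)$ consider the metric $$g=\frac{\delta}{\varphi(\xi(x))^2}+f(\xi(x))^2g_F\quad\text{on }\xi^{-1}((a,b))\times F^d .$$ If $\|\alpha\|^2=0$ and $\lambda_F>0$, then there is no choice of $\varphi,f,h$ for which $g$ is an expanding or steady gradient Yamabe soliton with potential function $h\circ\xi$. Similarly, if $\|\alpha\|^2=0$ and $\lambda_F<0$, then there is no choice of $\varphi,f,h$ for which $g$ is a shrinking or steady gradient Yamabe soliton with potential function $h\circ\xi$.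
   Context: A semi-Riemannian manifold $(M,g)$ is a gradient Yamabe soliton with potential function $u\in C^\infty(M)$ and soliton constant $\rho\in\mathbb R$ if $(S_g-\rho)g=\mathrm{Hess}_g(u)$, where $S_g$ is the scalar curvature of $g$. It is shrinking, steady or expanding if $\rho>0$, $\rho=0$ or $\rho<0$, respectively. The function $h\circ\xi$ is regarded as a function on $\xi^{-1}((a,b))\times F$ via the projection to the first factor. *)

theory Defs
  imports "HOL-Analysis.Analysis"
begin

section \<open>Smooth functions on open subsets of a Euclidean space\<close>

definition dderiv :: "'a::real_normed_vector \<Rightarrow> ('a \<Rightarrow> real) \<Rightarrow> 'a \<Rightarrow> real" where
  "dderiv v f x = deriv (\<lambda>t. f (x + t *\<^sub>R v)) 0"

abbreviation pdrv :: "'m::finite \<Rightarrow> (real^'m \<Rightarrow> real) \<Rightarrow> real^'m \<Rightarrow> real" where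
  "pdrv i \<equiv> dderiv (axis i 1)"

text \<open>
  \<open>C\<^sup>\<infinity>\<close>, for open \<open>S\<close>: every iterated partial derivative (including the function itself) is
  totally differentiable on \<open>S\<close>. For \<open>'a = real\<close> this says that all iterates of the ordinary
  derivative are differentiable.
\<close>

definition smooth_on :: "'a::euclidean_space set \<Rightarrow> ('a \<Rightarrow> real) \<Rightarrow> bool" where
  "smooth_on S f \<longleftrightarrow> (\<forall>vs. set vs \<subseteq> Basis \<longrightarrow> foldr dderiv vs f differentiable_on S)"


section \<open>Curvature and Hessian in coordinates\<close>

text \<open>
  Here \<open>G\<close> is the matrix \<open>(g\<^sub>i\<^sub>j)\<close> of a metric as a function of the coordinates.
  \<open>christoffel G k i j\<close> is \<open>\<Gamma>\<^sup>k\<^sub>i\<^sub>j\<close>, the Christoffel symbol of the Levi-Civita connection.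
\<close>

definition christoffel ::
    "(real^'m \<Rightarrow> real^'m^'m) \<Rightarrow> 'm::finite \<Rightarrow> 'm \<Rightarrow> 'm \<Rightarrow> real^'m \<Rightarrow> real" where
  "christoffel G k i j x =
     (1/2) * (\<Sum>l\<in>UNIV. matrix_inv (G x) $ k $ l *
       (pdrv i (\<lambda>y. G y $ j $ l) x + pdrv j (\<lambda>y. G y $ i $ l) x - pdrv l (\<lambda>y. G y $ i $ j) x))"

text \<open>
  \<open>riemann G l k i j\<close> is the coefficient \<open>R\<^sup>l\<^sub>k\<^sub>i\<^sub>j\<close> in \<open>R(\<partial>\<^sub>i, \<partial>\<^sub>j)\<partial>\<^sub>k = (\<Sum>l. R\<^sup>l\<^sub>k\<^sub>i\<^sub>j \<partial>\<^sub>l)\<close>, where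
  \<open>R(X,Y) = [\<nabla>\<^sub>X, \<nabla>\<^sub>Y] - \<nabla>\<^sub>[\<^sub>X\<^sub>,\<^sub>Y\<^sub>]\<close>. With \<open>Ric(Y,Z) = tr (X \<mapsto> R(X,Y)Z)\<close>, round spheres have positive
  scalar curvature.
\<close>

definition riemann ::
    "(real^'m \<Rightarrow> real^'m^'m) \<Rightarrow> 'm::finite \<Rightarrow> 'm \<Rightarrow> 'm \<Rightarrow> 'm \<Rightarrow> real^'m \<Rightarrow> real" where
  "riemann G l k i j x =
     pdrv i (christoffel G l j k) x - pdrv j (christoffel G l i k) x
     + (\<Sum>m\<in>UNIV. christoffel G l i m x * christoffel G m j k x
                  - christoffel G l j m x * christoffel G m i k x)"

definition ricci ::
    "(real^'m \<Rightarrow> real^'m^'m) \<Rightarrow> 'm::finite \<Rightarrow> 'm \<Rightarrow> real^'m \<Rightarrow> real" where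
  "ricci G j k x = (\<Sum>i\<in>UNIV. riemann G i k i j x)"

definition scalar_curv :: "(real^'m \<Rightarrow> real^'m^'m::finite) \<Rightarrow> real^'m \<Rightarrow> real" where
  "scalar_curv G x = (\<Sum>j\<in>UNIV. \<Sum>k\<in>UNIV. matrix_inv (G x) $ j $ k * ricci G j k x)"

definition hessian ::
    "(real^'m \<Rightarrow> real^'m^'m) \<Rightarrow> (real^'m \<Rightarrow> real) \<Rightarrow> 'm::finite \<Rightarrow> 'm \<Rightarrow> real^'m \<Rightarrow> real" where
  "hessian G u i j x =
     pdrv i (pdrv j u) x - (\<Sum>k\<in>UNIV. christoffel G k i j x * pdrv k u x)"


section \<open>Semi-Riemannian manifolds\<close>

text \<open>
  The smooth structure is given by an atlas of charts \<open>coord M c : cdom M c \<rightarrow> \<real>\<^sup>m\<close>, indexed by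
  \<open>c \<in> charts M\<close>. The metric tensor is given by its component matrices: \<open>gmat M c p\<close> is the
  matrix of \<open>g\<^sub>p\<close> with respect to the coordinate frame of the chart \<open>c\<close> around \<open>p\<close>.
  The dimension is \<open>CARD('m)\<close>.
\<close>

record ('p, 'c, 'm) metric_manifold =
  ptop :: "'p topology"
  charts :: "'c set"
  cdom :: "'c \<Rightarrow> 'p set"
  coord :: "'c \<Rightarrow> 'p \<Rightarrow> real^('m::finite)"
  gmat :: "'c \<Rightarrow> 'p \<Rightarrow> real^'m^'m"

definition in_chart :: "('p, 'c, 'm::finite) metric_manifold \<Rightarrow> 'c \<Rightarrow> ('p \<Rightarrow> 'b) \<Rightarrow> real^'m \<Rightarrow> 'b" where
  "in_chart M c u = u \<circ> inv_into (cdom M c) (coord M c)"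

definition smooth_manifold :: "('p, 'c, 'm::finite) metric_manifold \<Rightarrow> bool" where
  "smooth_manifold M \<longleftrightarrow>
     topspace (ptop M) \<noteq> {} \<and> Hausdorff_space (ptop M) \<and> second_countable (ptop M) \<and>
     (\<Union>c\<in>charts M. cdom M c) = topspace (ptop M) \<and>
     (\<forall>c\<in>charts M. openin (ptop M) (cdom M c) \<and> open (coord M c ` cdom M c) \<and>
        homeomorphic_map (subtopology (ptop M) (cdom M c)) (top_of_set (coord M c ` cdom M c))
          (coord M c)) \<and>
     (\<forall>c\<in>charts M. \<forall>c'\<in>charts M. \<forall>k.
        smooth_on (coord M c' ` (cdom M c \<inter> cdom M c')) (in_chart M c' (\<lambda>p. coord M c p $ k)))"

definition jacobian :: "('p, 'c, 'm::finite) metric_manifold \<Rightarrow> 'c \<Rightarrow> 'c \<Rightarrow> 'p \<Rightarrow> real^'m^'m" where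
  "jacobian M c c' p =
     (\<chi> k i. pdrv i (in_chart M c' (\<lambda>q. coord M c q $ k)) (coord M c' p))"

definition neg_index :: "real^'m^'m::finite \<Rightarrow> nat" where
  "neg_index A = Max {dim V |V. subspace V \<and> (\<forall>v\<in>V. v \<noteq> 0 \<longrightarrow> v \<bullet> (A *v v) < 0)}"

text \<open>
  A metric tensor is a smooth symmetric nondegenerate tensor field of type \<open>(0,2)\<close> of constant
  index. The tensor transformation law makes the local matrices represent one tensor field.
\<close>

definition semi_riemannian_manifold :: "('p, 'c, 'm::finite) metric_manifold \<Rightarrow> bool" where
  "semi_riemannian_manifold M \<longleftrightarrow> smooth_manifold M \<and>
     (\<forall>c\<in>charts M. \<forall>i j. smooth_on (coord M c ` cdom M c) (in_chart M c (\<lambda>p. gmat M c p $ i $ j))) \<and>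
     (\<forall>c\<in>charts M. \<forall>c'\<in>charts M. \<forall>p\<in>cdom M c \<inter> cdom M c'.
        gmat M c' p = transpose (jacobian M c c' p) ** gmat M c p ** jacobian M c c' p) \<and>
     (\<forall>c\<in>charts M. \<forall>p\<in>cdom M c. transpose (gmat M c p) = gmat M c p \<and> det (gmat M c p) \<noteq> 0) \<and>
     (\<exists>q. \<forall>c\<in>charts M. \<forall>p\<in>cdom M c. neg_index (gmat M c p) = q)"

definition smooth_fun :: "('p, 'c, 'm::finite) metric_manifold \<Rightarrow> ('p \<Rightarrow> real) \<Rightarrow> bool" where
  "smooth_fun M u \<longleftrightarrow> (\<forall>c\<in>charts M. smooth_on (coord M c ` cdom M c) (in_chart M c u))"

text \<open>
  Scalar curvature and the components of the Hessian at the point \<open>p\<close>, computed in the chart \<open>c\<close>.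
  The former does not depend on the chart, and the latter transform as a tensor.
\<close>

definition scalar_curvature :: "('p, 'c, 'm::finite) metric_manifold \<Rightarrow> 'c \<Rightarrow> 'p \<Rightarrow> real" where
  "scalar_curvature M c p = scalar_curv (in_chart M c (gmat M c)) (coord M c p)"

definition Hess ::
    "('p, 'c, 'm::finite) metric_manifold \<Rightarrow> ('p \<Rightarrow> real) \<Rightarrow> 'c \<Rightarrow> 'p \<Rightarrow> real^'m^'m" where
  "Hess M u c p =
     (\<chi> i j. hessian (in_chart M c (gmat M c)) (in_chart M c u) i j (coord M c p))"

definition constant_scalar_curvature ::
    "('p, 'c, 'm::finite) metric_manifold \<Rightarrow> real \<Rightarrow> bool" where
  "constant_scalar_curvature M k \<longleftrightarrow> (\<forall>c\<in>charts M. \<forall>p\<in>cdom M c. scalar_curvature M c p = k)"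


section \<open>Gradient Yamabe solitons\<close>

text \<open>
  The following are meant for \<open>M\<close> a semi-Riemannian manifold. The defining equation is
  \<open>(S\<^sub>g - \<rho>) g = Hess\<^sub>g(u)\<close>, read in every chart.
\<close>

definition gradient_yamabe_soliton ::
    "('p, 'c, 'm::finite) metric_manifold \<Rightarrow> ('p \<Rightarrow> real) \<Rightarrow> real \<Rightarrow> bool" where
  "gradient_yamabe_soliton M u \<rho> \<longleftrightarrow> smooth_fun M u \<and>
     (\<forall>c\<in>charts M. \<forall>p\<in>cdom M c. (scalar_curvature M c p - \<rho>) *\<^sub>R gmat M c p = Hess M u c p)"

definition shrinking_soliton ::
    "('p, 'c, 'm::finite) metric_manifold \<Rightarrow> ('p \<Rightarrow> real) \<Rightarrow> bool" where
  "shrinking_soliton M u \<longleftrightarrow> (\<exists>\<rho>>0. gradient_yamabe_soliton M u \<rho>)"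

definition steady_soliton ::
    "('p, 'c, 'm::finite) metric_manifold \<Rightarrow> ('p \<Rightarrow> real) \<Rightarrow> bool" where
  "steady_soliton M u \<longleftrightarrow> gradient_yamabe_soliton M u 0"

definition expanding_soliton ::
    "('p, 'c, 'm::finite) metric_manifold \<Rightarrow> ('p \<Rightarrow> real) \<Rightarrow> bool" where
  "expanding_soliton M u \<longleftrightarrow> (\<exists>\<rho><0. gradient_yamabe_soliton M u \<rho>)"


section \<open>Conformally flat base warped with a fibre\<close>

text \<open>
  \<open>warped_manifold \<Omega> \<epsilon> \<phi> f F\<close> is the product of the open set \<open>\<Omega> \<subseteq> \<real>\<^sup>n\<close> with \<open>F\<close>, with the metric
  \<open>\<delta> / \<phi>\<^sup>2 + f\<^sup>2 g\<^sub>F\<close>, where \<open>\<delta> = (\<Sum>i. \<epsilon>\<^sub>i dx\<^sub>i \<otimes> dx\<^sub>i)\<close>. Its charts are the products of the identity chart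
  of \<open>\<Omega>\<close> with the charts of \<open>F\<close>, so they are indexed by the charts of \<open>F\<close>. The coordinate indices
  \<open>Inl i\<close> belong to \<open>\<Omega>\<close>, the indices \<open>Inr a\<close> to \<open>F\<close>.
\<close>

definition warped_manifold ::
    "(real^'n) set \<Rightarrow> real^'n \<Rightarrow> (real^'n \<Rightarrow> real) \<Rightarrow> (real^'n \<Rightarrow> real) \<Rightarrow>
     ('p, 'c, 'd::finite) metric_manifold \<Rightarrow> ((real^'n) \<times> 'p, 'c, 'n::finite + 'd) metric_manifold" where
  "warped_manifold \<Omega> \<epsilon> \<phi> f F =
     \<lparr> ptop = prod_topology (top_of_set \<Omega>) (ptop F),
       charts = charts F,
       cdom = (\<lambda>c. \<Omega> \<times> cdom F c),
       coord = (\<lambda>c (x, p). \<chi> k. case k of Inl i \<Rightarrow> x $ i | Inr a \<Rightarrow> coord F c p $ a),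
       gmat = (\<lambda>c (x, p). \<chi> k l. case (k, l) of
           (Inl i, Inl j) \<Rightarrow> (if i = j then \<epsilon> $ i / (\<phi> x)\<^sup>2 else 0)
         | (Inr a, Inr b) \<Rightarrow> (f x)\<^sup>2 * gmat F c p $ a $ b
         | _ \<Rightarrow> 0) \<rparr>"

definition linear_form :: "real^'n::finite \<Rightarrow> real^'n \<Rightarrow> real" where
  "linear_form \<alpha> x = (\<Sum>i\<in>UNIV. \<alpha> $ i * x $ i)"

definition smooth_positive_on :: "real set \<Rightarrow> (real \<Rightarrow> real) \<Rightarrow> bool" where
  "smooth_positive_on I w \<longleftrightarrow> smooth_on I w \<and> (\<forall>t\<in>I. w t > 0)"

text \<open>
  The warped metric whose conformal factor and warping function depend on \<open>\<xi>(x) = (\<Sum>i. \<alpha>\<^sub>i x\<^sub>i)\<close>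
  only, over the region \<open>\<xi>\<^sup>-\<^sup>1(I)\<close>.
\<close>

definition invariant_warped_manifold ::
    "real^'n \<Rightarrow> real^'n \<Rightarrow> real set \<Rightarrow> (real \<Rightarrow> real) \<Rightarrow> (real \<Rightarrow> real) \<Rightarrow>
     ('p, 'c, 'd::finite) metric_manifold \<Rightarrow> ((real^'n) \<times> 'p, 'c, 'n::finite + 'd) metric_manifold" where
  "invariant_warped_manifold \<epsilon> \<alpha> I \<phi> f F =
     warped_manifold (linear_form \<alpha> -` I) \<epsilon> (\<phi> \<circ> linear_form \<alpha>) (f \<circ> linear_form \<alpha>) F"

end

theory Submission
  imports Defs
begin

text \<open>
  The potential and both coefficient functions depend on \<open>\<xi>\<close> alone, and \<open>d\<xi>\<close> is a null covector of
  \<open>\<delta>\<close>. Everything that the derivatives of \<open>\<phi>\<close>, \<open>f\<close>, \<open>h\<close> contribute to the scalar curvature and to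
  the trace of the Hessian over the base is therefore a multiple of \<open>\<Sum>i. \<epsilon>\<^sub>i \<alpha>\<^sub>i\<^sup>2 = 0\<close>.

  \<^item> The conformal factor, the warping function and the fibre contribute to the base block of the
    Ricci tensor only a multiple of \<open>\<alpha> \<otimes> \<alpha>\<close>, which is trace free, and the fibre block is the Ricci
    tensor of \<open>F\<close>. Hence \<open>S\<^sub>g = \<lambda>\<^sub>F / f\<^sup>2\<close> (\<open>scalar_curv_G\<close>).

  \<^item> The base block of the Hessian of the potential is also a multiple of \<open>\<alpha> \<otimes> \<alpha>\<close>. Tracing
    \<open>(S\<^sub>g - \<rho>) g = Hess u\<close> over the base gives \<open>n (S\<^sub>g - \<rho>) = 0\<close>, so \<open>S\<^sub>g = \<rho>\<close>
    (\<open>soliton_scalar_curv\<close>).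

  Together \<open>\<rho> = \<lambda>\<^sub>F / f\<^sup>2\<close>, so \<open>\<rho>\<close> and \<open>\<lambda>\<^sub>F\<close> have the same sign; this excludes all the listed
  combinations at once. The identity is pointwise, so one point in one chart is enough, and the
  curvature is computed there from the Christoffel symbols.
\<close>

section \<open>Directional derivatives and sums over a product chart\<close>

text \<open>
  Chart expressions are known only on the image of the chart, so all partial derivatives are
  taken after passing to an explicit formula valid on an open set.
\<close>

lemma dderiv_cong:
  assumes "open D" "x \<in> D" "\<And>y. y \<in> D \<Longrightarrow> f y = g y"
  shows "dderiv v f x = dderiv v g x"
proof -
  have "open ((\<lambda>t::real. x + t *\<^sub>R v) -` D)"
    by (intro open_vimage assms(1) continuous_intros)
  then have "\<forall>\<^sub>F t in nhds 0. t \<in> (\<lambda>t::real. x + t *\<^sub>R v) -` D"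
    by (rule eventually_nhds_in_open) (use assms in auto)
  then have "\<forall>\<^sub>F t in nhds 0. f (x + t *\<^sub>R v) = g (x + t *\<^sub>R v)"
    by eventually_elim (use assms in auto)
  then show ?thesis unfolding dderiv_def by (rule deriv_cong_ev) simp
qed

lemma has_dderiv_of_differentiable:
  fixes f :: "'a::real_normed_vector \<Rightarrow> real"
  assumes "f differentiable (at x)"
  shows "((\<lambda>t. f (x + t *\<^sub>R v)) has_real_derivative dderiv v f x) (at 0)"
proof -
  have "(\<lambda>t::real. x + t *\<^sub>R v) differentiable (at 0)" by simp
  then have "(f \<circ> (\<lambda>t::real. x + t *\<^sub>R v)) differentiable (at 0)"
    using assms by (intro differentiable_chain_at) auto
  then have "(\<lambda>t. f (x + t *\<^sub>R v)) field_differentiable (at 0)"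
    by (simp add: o_def field_differentiable_def real_differentiable_def)
  then show ?thesis
    unfolding dderiv_def by (simp add: DERIV_deriv_iff_field_differentiable)
qed

lemma dderiv_one_eq_deriv: "dderiv 1 f = deriv f" for f :: "real \<Rightarrow> real"
proof
  fix x
  have "((\<lambda>t. f (x + t)) has_field_derivative d) (at 0) \<longleftrightarrow> (f has_field_derivative d) (at x)" for d
    using DERIV_shift[of f d 0 x] by (simp add: add.commute)
  then show "dderiv 1 f x = deriv f x"
    unfolding dderiv_def deriv_def by simp
qed

lemma smooth_on_real_derivs:
  fixes w :: "real \<Rightarrow> real"
  assumes "smooth_on I w" "open I" "t \<in> I"
  shows "(w has_real_derivative deriv w t) (at t)"
    and "(deriv w has_real_derivative deriv (deriv w) t) (at t)"
proof -
  have "foldr dderiv [] w differentiable_on I" "foldr dderiv [1] w differentiable_on I"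
    using assms(1) unfolding smooth_on_def by (auto simp del: foldr.simps)
  then have "w differentiable (at t)" "deriv w differentiable (at t)"
    using assms by (auto simp: differentiable_on_eq_differentiable_at dderiv_one_eq_deriv)
  then show "(w has_real_derivative deriv w t) (at t)"
    "(deriv w has_real_derivative deriv (deriv w) t) (at t)"
    by (auto simp: DERIV_deriv_iff_field_differentiable field_differentiable_def real_differentiable_def)
qed

lemma sum_UNIV_Plus:
  "sum g (UNIV :: ('n::finite + 'd::finite) set) = (\<Sum>i\<in>UNIV. g (Inl i)) + (\<Sum>a\<in>UNIV. g (Inr a))"
  by (subst UNIV_Plus_UNIV[symmetric], subst sum.Plus) auto

lemma matrix_inv_eqI:
  fixes A B :: "real^'m^'m::finite"
  assumes "A ** B = mat 1"
  shows "matrix_inv A = B"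
proof -
  have BA: "B ** A = mat 1" using assms by (simp add: matrix_left_right_inverse)
  have "A ** matrix_inv A = mat 1"
    unfolding matrix_inv_def
    using someI[where P="\<lambda>A'. A ** A' = mat 1 \<and> A' ** A = mat 1" and x=B] assms BA by blast
  then have "B ** (A ** matrix_inv A) = B" by simp
  then show ?thesis by (simp add: matrix_mul_assoc BA)
qed

definition base_part :: "real^('n::finite + 'd::finite) \<Rightarrow> real^'n" where
  "base_part y = (\<chi> i. y $ Inl i)"

definition fibre_part :: "real^('n::finite + 'd::finite) \<Rightarrow> real^'d" where
  "fibre_part y = (\<chi> a. y $ Inr a)"

lemma part_shift:
  "base_part (y + t *\<^sub>R axis (Inl i) 1) = base_part y + t *\<^sub>R axis i 1"
  "base_part (y + t *\<^sub>R axis (Inr a) 1) = base_part y"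
  "fibre_part (y + t *\<^sub>R axis (Inl i) 1) = fibre_part y"
  "fibre_part (y + t *\<^sub>R axis (Inr a) 1) = fibre_part y + t *\<^sub>R axis a 1"
  by (auto simp: base_part_def fibre_part_def vec_eq_iff axis_def)

lemma linear_form_shift: "linear_form \<alpha> (x + t *\<^sub>R axis i 1) = linear_form \<alpha> x + t * \<alpha> $ i"
  by (simp add: linear_form_def axis_def distrib_left sum.distrib mult_delta_right mult.commute[of t])

lemma continuous_parts:
  "continuous_on A (\<lambda>y. linear_form \<alpha> (base_part y))" "continuous_on A fibre_part"
  by (auto simp: linear_form_def base_part_def fibre_part_def intro!: continuous_intros)

section \<open>Curvature of the warped metric\<close>

text \<open>
  The metric in a single product chart: \<open>I\<close> is the range of \<open>\<xi>\<close>, \<open>V\<close> the image of a chart of the fibre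
  and \<open>H\<close> the matrix of the fibre metric in it. Nothing is said about \<open>G\<close> outside the open set \<open>D\<close>.
\<close>

locale null_warped =
  fixes \<epsilon> \<alpha> :: "real^'n" and I :: "real set" and \<phi> f :: "real \<Rightarrow> real"
    and V :: "(real^'d) set" and H :: "real^'d \<Rightarrow> real^'d^'d"
    and G :: "real^('n::finite + 'd::finite) \<Rightarrow> real^('n + 'd)^('n + 'd)"
    and \<xi> D
  defines "\<xi> y \<equiv> linear_form \<alpha> (base_part y)"
    and "D \<equiv> {y. \<xi> y \<in> I \<and> fibre_part y \<in> V}"
  assumes sign_sq: "\<epsilon> $ i * \<epsilon> $ i = 1"
    and null: "(\<Sum>i\<in>UNIV. \<epsilon> $ i * (\<alpha> $ i)\<^sup>2) = 0"
    and open_I: "open I" and open_V: "open V"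
    and \<phi>: "smooth_positive_on I \<phi>" and f: "smooth_positive_on I f"
    and H_diff: "z \<in> V \<Longrightarrow> (\<lambda>z. H z $ b $ c) differentiable (at z)"
    and H_sym: "z \<in> V \<Longrightarrow> H z $ b $ c = H z $ c $ b"
    and H_inv: "z \<in> V \<Longrightarrow> H z ** matrix_inv (H z) = mat 1"
    and G_base: "y \<in> D \<Longrightarrow> G y $ Inl i $ Inl j = (if i = j then \<epsilon> $ i / (\<phi> (\<xi> y))\<^sup>2 else 0)"
    and G_mixed: "y \<in> D \<Longrightarrow> G y $ Inl i $ Inr c = 0" "y \<in> D \<Longrightarrow> G y $ Inr c $ Inl i = 0"
    and G_fibre: "y \<in> D \<Longrightarrow> G y $ Inr b $ Inr c = (f (\<xi> y))\<^sup>2 * H (fibre_part y) $ b $ c"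
begin

text \<open>
  The functions of \<open>\<xi>\<close> in the Christoffel symbols: \<open>P\<close> and \<open>Q\<close> are the logarithmic derivatives of \<open>\<phi>\<close>
  and \<open>f\<close>, and \<open>-K g\<^sub>F\<close> multiplies the \<open>\<delta>\<close>-gradient of \<open>\<xi>\<close> in the base component of \<open>\<nabla>\<^sub>X Y\<close> for
  fibre fields \<open>X\<close>, \<open>Y\<close>.
\<close>

definition P :: "real \<Rightarrow> real" where "P t = deriv \<phi> t / \<phi> t"
definition Q :: "real \<Rightarrow> real" where "Q t = deriv f t / f t"
definition K :: "real \<Rightarrow> real" where "K t = (\<phi> t)\<^sup>2 * f t * deriv f t"

lemma open_D: "open D"
proof -
  have "D = \<xi> -` I \<inter> fibre_part -` V" by (auto simp: D_def)
  moreover have "open (\<xi> -` I)" "open (fibre_part -` V :: (real^('n+'d)) set)"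
    unfolding \<xi>_def using open_I open_V continuous_parts open_vimage by (auto intro!: open_vimage)
  ultimately show ?thesis by auto
qed

lemma D_parts: "y \<in> D \<Longrightarrow> \<xi> y \<in> I" "y \<in> D \<Longrightarrow> fibre_part y \<in> V" by (auto simp: D_def)

lemma pos: "y \<in> D \<Longrightarrow> \<phi> (\<xi> y) > 0" "y \<in> D \<Longrightarrow> f (\<xi> y) > 0"
  using \<phi> f by (auto simp: D_def smooth_positive_on_def)

lemma \<phi>_f_derivs:
  assumes "t \<in> I"
  shows "(\<phi> has_real_derivative deriv \<phi> t) (at t)"
    and "(deriv \<phi> has_real_derivative deriv (deriv \<phi>) t) (at t)"
    and "(f has_real_derivative deriv f t) (at t)"
    and "(deriv f has_real_derivative deriv (deriv f) t) (at t)"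
  using smooth_on_real_derivs[OF _ open_I assms] \<phi> f
  by (auto simp: smooth_positive_on_def)

text \<open>
  All components met below separate into a function of \<open>\<xi>\<close> times a function of the fibre
  coordinates, so this lemma and \<open>pdrv_fibre\<close> compute all their partial derivatives.
\<close>

lemma pdrv_base:
  assumes y: "y \<in> D" and F: "\<And>y. y \<in> D \<Longrightarrow> F y = r (\<xi> y) * k (fibre_part y)"
    and r: "(r has_real_derivative r') (at (\<xi> y))"
  shows "pdrv (Inl i) F y = \<alpha> $ i * r' * k (fibre_part y)"
proof -
  have "pdrv (Inl i) F y = pdrv (Inl i) (\<lambda>y. r (\<xi> y) * k (fibre_part y)) y"
    by (rule dderiv_cong[OF open_D y F])
  also have "\<dots> = deriv (\<lambda>t. r (\<xi> y + t * \<alpha> $ i) * k (fibre_part y)) 0"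
    by (simp add: dderiv_def part_shift \<xi>_def linear_form_shift)
  also have "\<dots> = \<alpha> $ i * r' * k (fibre_part y)"
  proof (rule DERIV_imp_deriv)
    have "((\<lambda>t. r (\<xi> y + t * \<alpha> $ i)) has_real_derivative r' * \<alpha> $ i) (at 0)"
      by (rule DERIV_chain2[where f=r]) (auto intro!: derivative_eq_intros simp: r)
    then show "((\<lambda>t. r (\<xi> y + t * \<alpha> $ i) * k (fibre_part y))
        has_real_derivative \<alpha> $ i * r' * k (fibre_part y)) (at 0)"
      by (auto intro!: derivative_eq_intros)
  qed
  finally show ?thesis .
qed

text \<open>
  With no factor depending on \<open>\<xi>\<close> the two difference quotients coincide, so \<open>k\<close> may be any
  function; this is what carries the derivatives of the fibre's Christoffel symbols over.
\<close>

lemma pdrv_fibre_pullback: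
  assumes "y \<in> D" "\<And>y. y \<in> D \<Longrightarrow> F y = k (fibre_part y)"
  shows "pdrv (Inr a) F y = pdrv a k (fibre_part y)"
  by (subst dderiv_cong[OF open_D assms]) (auto simp: dderiv_def part_shift)

lemma pdrv_fibre:
  assumes y: "y \<in> D" and F: "\<And>y. y \<in> D \<Longrightarrow> F y = r (\<xi> y) * k (fibre_part y)"
    and k: "k differentiable (at (fibre_part y))"
  shows "pdrv (Inr a) F y = r (\<xi> y) * pdrv a k (fibre_part y)"
proof -
  have "pdrv (Inr a) F y = pdrv (Inr a) (\<lambda>y. r (\<xi> y) * k (fibre_part y)) y"
    by (rule dderiv_cong[OF open_D y F])
  also have "\<dots> = deriv (\<lambda>t. r (\<xi> y) * k (fibre_part y + t *\<^sub>R axis a 1)) 0"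
    by (simp add: dderiv_def part_shift \<xi>_def)
  also have "\<dots> = r (\<xi> y) * pdrv a k (fibre_part y)"
    by (rule DERIV_imp_deriv, rule DERIV_cmult, rule has_dderiv_of_differentiable[OF k])
  finally show ?thesis .
qed

lemma pdrv_base_fun:
  assumes "y \<in> D" "\<And>y. y \<in> D \<Longrightarrow> F y = r (\<xi> y)" "(r has_real_derivative r') (at (\<xi> y))"
  shows "pdrv (Inl i) F y = \<alpha> $ i * r'" "pdrv (Inr a) F y = 0"
  using pdrv_base[of y F r "\<lambda>_. 1", OF assms(1) _ assms(3)]
    pdrv_fibre[of y F r "\<lambda>_. 1", OF assms(1)] assms(2)
  by (auto simp: dderiv_def)

lemma pdrv_const:
  assumes "y \<in> D" "\<And>y. y \<in> D \<Longrightarrow> F y = c"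
  shows "pdrv J F y = 0"
  using pdrv_base_fun[of y F "\<lambda>_. c" 0, OF assms] by (cases J) auto

lemma matrix_inv_G:
  assumes y: "y \<in> D"
  shows "matrix_inv (G y) $ Inl i $ Inl j = (if i = j then \<epsilon> $ i * (\<phi> (\<xi> y))\<^sup>2 else 0)"
    and "matrix_inv (G y) $ Inl i $ Inr c = 0"
    and "matrix_inv (G y) $ Inr c $ Inl i = 0"
    and "matrix_inv (G y) $ Inr b $ Inr c = matrix_inv (H (fibre_part y)) $ b $ c / (f (\<xi> y))\<^sup>2"
proof -
  define B :: "real^('n + 'd)^('n + 'd)" where
    "B = (\<chi> k l. case (k, l) of
        (Inl i, Inl j) \<Rightarrow> (if i = j then \<epsilon> $ i * (\<phi> (\<xi> y))\<^sup>2 else 0)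
      | (Inr b, Inr c) \<Rightarrow> matrix_inv (H (fibre_part y)) $ b $ c / (f (\<xi> y))\<^sup>2
      | _ \<Rightarrow> 0)"
  have HH: "(\<Sum>k\<in>UNIV. H (fibre_part y) $ b $ k * matrix_inv (H (fibre_part y)) $ k $ c)
      = (if b = c then 1 else 0)" for b c
    using H_inv[OF D_parts(2)[OF y]] by (simp add: vec_eq_iff matrix_matrix_mult_def mat_def)
  have p: "\<phi> (\<xi> y) \<noteq> 0" "f (\<xi> y) \<noteq> 0" using pos[OF y] by auto
  have prod: "(G y ** B) $ J $ K
      = (\<Sum>l\<in>UNIV. G y $ J $ Inl l * B $ Inl l $ K) + (\<Sum>c\<in>UNIV. G y $ J $ Inr c * B $ Inr c $ K)" for J K
    by (simp add: matrix_matrix_mult_def sum_UNIV_Plus)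
  have B: "B $ Inl i $ Inl j = (if i = j then \<epsilon> $ i * (\<phi> (\<xi> y))\<^sup>2 else 0)"
    "B $ Inl i $ Inr c = 0" "B $ Inr c $ Inl i = 0"
    "B $ Inr b $ Inr c = matrix_inv (H (fibre_part y)) $ b $ c / (f (\<xi> y))\<^sup>2" for i j b c
    by (auto simp: B_def)
  have "(G y ** B) $ Inl i $ Inl j = (if i = j then 1 else 0)" for i j
    using p
    by (simp add: prod B sign_sq G_base[OF y] G_mixed[OF y] mult_delta_left mult_delta_right)
  moreover have "(G y ** B) $ Inl i $ Inr c = 0" "(G y ** B) $ Inr c $ Inl i = 0" for i c
    by (simp_all add: prod B G_mixed[OF y])
  moreover have "(G y ** B) $ Inr b $ Inr c = (if b = c then 1 else 0)" for b c
    using p HH[of b c] by (simp add: prod B G_mixed[OF y] G_fibre[OF y])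
  ultimately have "(G y ** B) $ J $ K = mat 1 $ J $ K" for J K
    by (cases J; cases K) (simp_all add: mat_def)
  then have "G y ** B = mat 1" by (simp add: vec_eq_iff)
  then have "matrix_inv (G y) = B" by (rule matrix_inv_eqI)
  then show "matrix_inv (G y) $ Inl i $ Inl j = (if i = j then \<epsilon> $ i * (\<phi> (\<xi> y))\<^sup>2 else 0)"
    and "matrix_inv (G y) $ Inl i $ Inr c = 0"
    and "matrix_inv (G y) $ Inr c $ Inl i = 0"
    and "matrix_inv (G y) $ Inr b $ Inr c = matrix_inv (H (fibre_part y)) $ b $ c / (f (\<xi> y))\<^sup>2"
    by (simp_all add: B)
qed

lemma pdrv_G:
  assumes y: "y \<in> D"
  shows "pdrv (Inl k) (\<lambda>y. G y $ Inl i $ Inl j) y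
      = (if i = j then - 2 * \<epsilon> $ i * \<alpha> $ k * P (\<xi> y) / (\<phi> (\<xi> y))\<^sup>2 else 0)"
    and "pdrv (Inr a) (\<lambda>y. G y $ Inl i $ Inl j) y = 0"
    and "pdrv J (\<lambda>y. G y $ Inl i $ Inr c) y = 0"
    and "pdrv J (\<lambda>y. G y $ Inr c $ Inl i) y = 0"
    and "pdrv (Inl k) (\<lambda>y. G y $ Inr b $ Inr c) y
      = 2 * \<alpha> $ k * Q (\<xi> y) * (f (\<xi> y))\<^sup>2 * H (fibre_part y) $ b $ c"
    and "pdrv (Inr a) (\<lambda>y. G y $ Inr b $ Inr c) y
      = (f (\<xi> y))\<^sup>2 * pdrv a (\<lambda>z. H z $ b $ c) (fibre_part y)"
proof -
  note p = pos[OF y] and d = \<phi>_f_derivs[OF D_parts(1)[OF y]]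
  have r: "((\<lambda>t. if i = j then \<epsilon> $ i / (\<phi> t)\<^sup>2 else 0) has_real_derivative
      (if i = j then - 2 * \<epsilon> $ i * P (\<xi> y) / (\<phi> (\<xi> y))\<^sup>2 else 0)) (at (\<xi> y))"
    using p by (auto intro!: derivative_eq_intros d simp: P_def field_simps power2_eq_square)
  show "pdrv (Inl k) (\<lambda>y. G y $ Inl i $ Inl j) y
      = (if i = j then - 2 * \<epsilon> $ i * \<alpha> $ k * P (\<xi> y) / (\<phi> (\<xi> y))\<^sup>2 else 0)"
    by (subst pdrv_base_fun(1)[OF y G_base r]) auto
  show "pdrv (Inr a) (\<lambda>y. G y $ Inl i $ Inl j) y = 0"
    by (rule pdrv_base_fun(2)[OF y G_base r])
  show "pdrv J (\<lambda>y. G y $ Inl i $ Inr c) y = 0" "pdrv J (\<lambda>y. G y $ Inr c $ Inl i) y = 0"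
    by (rule pdrv_const[OF y], rule G_mixed, assumption)+
  have r: "((\<lambda>t. (f t)\<^sup>2) has_real_derivative 2 * Q (\<xi> y) * (f (\<xi> y))\<^sup>2) (at (\<xi> y))"
    using p by (auto intro!: derivative_eq_intros d simp: Q_def field_simps power2_eq_square)
  show "pdrv (Inl k) (\<lambda>y. G y $ Inr b $ Inr c) y
      = 2 * \<alpha> $ k * Q (\<xi> y) * (f (\<xi> y))\<^sup>2 * H (fibre_part y) $ b $ c"
    by (subst pdrv_base[where r="\<lambda>t. (f t)\<^sup>2" and k="\<lambda>z. H z $ b $ c", OF y G_fibre r]) auto
  show "pdrv (Inr a) (\<lambda>y. G y $ Inr b $ Inr c) y
      = (f (\<xi> y))\<^sup>2 * pdrv a (\<lambda>z. H z $ b $ c) (fibre_part y)"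
    by (rule pdrv_fibre[where r="\<lambda>t. (f t)\<^sup>2" and k="\<lambda>z. H z $ b $ c",
        OF y G_fibre H_diff[OF D_parts(2)[OF y]]])
qed

lemma H_inv_left:
  assumes "z \<in> V"
  shows "(\<Sum>l\<in>UNIV. matrix_inv (H z) $ c $ l * H z $ a $ l) = (if a = c then 1 else 0)"
proof -
  have "matrix_inv (H z) ** H z = mat 1"
    using H_inv[OF assms] matrix_left_right_inverse by metis
  then have "(\<Sum>l\<in>UNIV. matrix_inv (H z) $ c $ l * H z $ l $ a) = (if c = a then 1 else 0)"
    by (simp add: vec_eq_iff matrix_matrix_mult_def mat_def)
  then show ?thesis using H_sym[OF assms] by (metis (no_types, lifting) sum.cong)
qed

text \<open>
  The base block is that of a conformally flat metric, the mixed and fibre blocks are those of a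
  warped product; the Christoffel symbols of the fibre itself do not see the factor \<open>f\<^sup>2\<close>,
  which is constant along the fibres.
\<close>

lemma christoffel_G:
  assumes y: "y \<in> D"
  shows "christoffel G (Inl k) (Inl i) (Inl j) y
      = - P (\<xi> y) * ((if j = k then \<alpha> $ i else 0) + (if i = k then \<alpha> $ j else 0)
          - (if i = j then \<epsilon> $ i * \<epsilon> $ k * \<alpha> $ k else 0))"
    and "christoffel G (Inl k) (Inl i) (Inr a) y = 0"
    and "christoffel G (Inl k) (Inr a) (Inl i) y = 0"
    and "christoffel G (Inl k) (Inr a) (Inr b) y
      = - K (\<xi> y) * \<epsilon> $ k * \<alpha> $ k * H (fibre_part y) $ a $ b"
    and "christoffel G (Inr c) (Inl i) (Inl j) y = 0"
    and "christoffel G (Inr c) (Inl i) (Inr a) y = (if a = c then Q (\<xi> y) * \<alpha> $ i else 0)"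
    and "christoffel G (Inr c) (Inr a) (Inl i) y = (if a = c then Q (\<xi> y) * \<alpha> $ i else 0)"
    and "christoffel G (Inr c) (Inr a) (Inr b) y = christoffel H c a b (fibre_part y)"
proof -
  have p: "\<phi> (\<xi> y) \<noteq> 0" "f (\<xi> y) \<noteq> 0" using pos[OF y] by auto
  note s = christoffel_def sum_UNIV_Plus matrix_inv_G[OF y] pdrv_G[OF y] mult_delta_left mult_delta_right
  have "\<epsilon> $ i * (\<epsilon> $ i * x) = x" for i x
    using sign_sq[of i] by (simp add: mult.assoc[symmetric])
  then show "christoffel G (Inl k) (Inl i) (Inl j) y
      = - P (\<xi> y) * ((if j = k then \<alpha> $ i else 0) + (if i = k then \<alpha> $ j else 0)
          - (if i = j then \<epsilon> $ i * \<epsilon> $ k * \<alpha> $ k else 0))"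
    using p by (simp add: s)
  show "christoffel G (Inl k) (Inl i) (Inr a) y = 0"
    and "christoffel G (Inl k) (Inr a) (Inl i) y = 0"
    and "christoffel G (Inr c) (Inl i) (Inl j) y = 0"
    by (simp_all add: s)
  show "christoffel G (Inl k) (Inr a) (Inr b) y
      = - K (\<xi> y) * \<epsilon> $ k * \<alpha> $ k * H (fibre_part y) $ a $ b"
    using p by (simp add: s sum_negf) (simp add: K_def Q_def power2_eq_square)
  have q: "(\<Sum>l\<in>UNIV. matrix_inv (H (fibre_part y)) $ c $ l / (f (\<xi> y))\<^sup>2 *
      (2 * \<alpha> $ i * Q (\<xi> y) * (f (\<xi> y))\<^sup>2 * H (fibre_part y) $ a $ l))
    = 2 * (if a = c then Q (\<xi> y) * \<alpha> $ i else 0)"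
  proof -
    have "(\<Sum>l\<in>UNIV. matrix_inv (H (fibre_part y)) $ c $ l / (f (\<xi> y))\<^sup>2 *
      (2 * \<alpha> $ i * Q (\<xi> y) * (f (\<xi> y))\<^sup>2 * H (fibre_part y) $ a $ l))
     = (\<Sum>l\<in>UNIV. 2 * Q (\<xi> y) * \<alpha> $ i * (matrix_inv (H (fibre_part y)) $ c $ l * H (fibre_part y) $ a $ l))"
      using p by (intro sum.cong) auto
    then show ?thesis by (simp add: sum_distrib_left[symmetric] H_inv_left[OF D_parts(2)[OF y]])
  qed
  show "christoffel G (Inr c) (Inl i) (Inr a) y = (if a = c then Q (\<xi> y) * \<alpha> $ i else 0)"
    and "christoffel G (Inr c) (Inr a) (Inl i) y = (if a = c then Q (\<xi> y) * \<alpha> $ i else 0)"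
    by (simp_all only: s q add_0_right add_0_left diff_0_right) simp_all
  show "christoffel G (Inr c) (Inr a) (Inr b) y = christoffel H c a b (fibre_part y)"
    using p by (simp add: s) (auto intro!: sum.cong simp: field_simps)
qed

text \<open>
  The only form in which the nullity of \<open>\<alpha>\<close> enters the computation.
\<close>

lemma null_sumI:
  assumes "\<And>m. g m = c * (\<epsilon> $ m * (\<alpha> $ m)\<^sup>2)"
  shows "sum g UNIV = 0"
  by (simp add: assms sum_distrib_left[symmetric] null)

lemma P_Q_K_derivs:
  assumes "y \<in> D"
  shows "(P has_real_derivative deriv P (\<xi> y)) (at (\<xi> y))"
    and "(Q has_real_derivative deriv Q (\<xi> y)) (at (\<xi> y))"
    and "(K has_real_derivative deriv K (\<xi> y)) (at (\<xi> y))"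
proof -
  have p: "\<phi> (\<xi> y) \<noteq> 0" "f (\<xi> y) \<noteq> 0" using pos[OF assms] by auto
  have d: "\<phi> field_differentiable (at (\<xi> y))" "deriv \<phi> field_differentiable (at (\<xi> y))"
    "f field_differentiable (at (\<xi> y))" "deriv f field_differentiable (at (\<xi> y))"
    using \<phi>_f_derivs[OF D_parts(1)[OF assms]] unfolding field_differentiable_def by blast+
  have "P field_differentiable (at (\<xi> y))"
    unfolding P_def[abs_def] by (intro field_differentiable_divide d p)
  moreover have "Q field_differentiable (at (\<xi> y))"
    unfolding Q_def[abs_def] by (intro field_differentiable_divide d p)
  moreover have "K field_differentiable (at (\<xi> y))"
    unfolding K_def[abs_def] power2_eq_square by (intro field_differentiable_mult d)
  ultimately show "(P has_real_derivative deriv P (\<xi> y)) (at (\<xi> y))"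
    and "(Q has_real_derivative deriv Q (\<xi> y)) (at (\<xi> y))"
    and "(K has_real_derivative deriv K (\<xi> y)) (at (\<xi> y))"
    by (simp_all add: DERIV_deriv_iff_field_differentiable)
qed

lemma pdrv_christoffel_G:
  assumes y: "y \<in> D"
  shows "pdrv (Inl m) (christoffel G (Inl k) (Inl i) (Inl j)) y
      = - deriv P (\<xi> y) * \<alpha> $ m * ((if j = k then \<alpha> $ i else 0) + (if i = k then \<alpha> $ j else 0)
          - (if i = j then \<epsilon> $ i * \<epsilon> $ k * \<alpha> $ k else 0))"
    and "pdrv J (christoffel G (Inl k) (Inl i) (Inr a)) y = 0"
    and "pdrv J (christoffel G (Inr c) (Inl i) (Inl j)) y = 0"
    and "pdrv (Inl m) (christoffel G (Inl k) (Inr a) (Inr b)) y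
      = - deriv K (\<xi> y) * \<alpha> $ m * \<epsilon> $ k * \<alpha> $ k * H (fibre_part y) $ a $ b"
    and "pdrv (Inl m) (christoffel G (Inr c) (Inr a) (Inl i)) y
      = (if a = c then deriv Q (\<xi> y) * \<alpha> $ i * \<alpha> $ m else 0)"
    and "pdrv (Inr e) (christoffel G (Inr c) (Inr a) (Inr b)) y
      = pdrv e (christoffel H c a b) (fibre_part y)"
proof -
  note d = P_Q_K_derivs[OF y]
  let ?v = "(if j = k then \<alpha> $ i else 0) + (if i = k then \<alpha> $ j else 0)
          - (if i = j then \<epsilon> $ i * \<epsilon> $ k * \<alpha> $ k else 0)"
  show "pdrv (Inl m) (christoffel G (Inl k) (Inl i) (Inl j)) y = - deriv P (\<xi> y) * \<alpha> $ m * ?v"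
    by (subst pdrv_base[where r = P and k = "\<lambda>_. - ?v", OF y _ d(1)])
      (simp_all only: christoffel_G mult_minus_left mult_minus_right mult_ac)
  show "pdrv J (christoffel G (Inl k) (Inl i) (Inr a)) y = 0"
    "pdrv J (christoffel G (Inr c) (Inl i) (Inl j)) y = 0"
    by (auto intro!: pdrv_const[OF y] simp: christoffel_G)
  show "pdrv (Inl m) (christoffel G (Inl k) (Inr a) (Inr b)) y
      = - deriv K (\<xi> y) * \<alpha> $ m * \<epsilon> $ k * \<alpha> $ k * H (fibre_part y) $ a $ b"
    by (subst pdrv_base[where r = K and k = "\<lambda>z. - \<epsilon> $ k * \<alpha> $ k * H z $ a $ b", OF y _ d(3)])
      (simp_all add: christoffel_G)
  show "pdrv (Inl m) (christoffel G (Inr c) (Inr a) (Inl i)) y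
      = (if a = c then deriv Q (\<xi> y) * \<alpha> $ i * \<alpha> $ m else 0)"
    by (subst pdrv_base[where r = Q and k = "\<lambda>z. if a = c then \<alpha> $ i else 0", OF y _ d(2)])
      (simp_all add: christoffel_G)
  show "pdrv (Inr e) (christoffel G (Inr c) (Inr a) (Inr b)) y
      = pdrv e (christoffel H c a b) (fibre_part y)"
    by (rule pdrv_fibre_pullback[OF y]) (simp add: christoffel_G)
qed

text \<open>
  Contracting against an arbitrary covector \<open>X\<close> resolves the Kronecker deltas once, so that the
  quadratic terms of the curvature need no double sums over deltas.
\<close>

lemma christoffel_base_contract:
  assumes "y \<in> D"
  shows "(\<Sum>m\<in>UNIV. X m * christoffel G (Inl m) (Inl i) (Inl j) y)
    = - P (\<xi> y) * (X j * \<alpha> $ i + X i * \<alpha> $ j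
        - (if i = j then \<epsilon> $ i * (\<Sum>m\<in>UNIV. \<epsilon> $ m * \<alpha> $ m * X m) else 0))"
proof -
  have e: "X m * christoffel G (Inl m) (Inl i) (Inl j) y
      = - P (\<xi> y) * (if j = m then X m * \<alpha> $ i else 0) - P (\<xi> y) * (if i = m then X m * \<alpha> $ j else 0)
        + P (\<xi> y) * (if i = j then \<epsilon> $ i * (\<epsilon> $ m * \<alpha> $ m * X m) else 0)" for m
    by (simp add: christoffel_G[OF assms] algebra_simps)
  show ?thesis
    unfolding e sum.distrib sum_subtractf sum_distrib_left[symmetric]
    by (cases "i = j") (simp_all add: sum_distrib_left sum_negf algebra_simps)
qed

lemma christoffel_base_trace:
  "y \<in> D \<Longrightarrow> christoffel G (Inl i) (Inl i) (Inl m) y = - P (\<xi> y) * \<alpha> $ m"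
  by (simp add: christoffel_G sign_sq)

text \<open>
  The diagonal is all that the scalar curvature sees, since the base metric is diagonal; only the
  shape \<open>C \<alpha>\<^sub>j\<^sup>2\<close> with \<open>C\<close> independent of \<open>j\<close> matters, because it makes the trace vanish.
\<close>

lemma ricci_base:
  assumes y: "y \<in> D"
  obtains C where "\<And>j. ricci G (Inl j) (Inl j) y = C * (\<alpha> $ j)\<^sup>2"
proof
  fix j
  let ?n = "real CARD('n)" and ?d = "real CARD('d)"
  let ?P = "P (\<xi> y)" and ?Q = "Q (\<xi> y)" and ?P' = "deriv P (\<xi> y)" and ?Q' = "deriv Q (\<xi> y)"
  have n: "(\<Sum>m\<in>UNIV. \<epsilon> $ m * \<alpha> $ m * (c * \<alpha> $ m)) = 0" for c
    by (rule null_sumI[of _ c]) (simp add: power2_eq_square)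
  have q1: "(\<Sum>m\<in>UNIV. (c * \<alpha> $ m) * christoffel G (Inl m) (Inl j) (Inl j) y) = - 2 * ?P * c * (\<alpha> $ j)\<^sup>2" for c
    by (subst christoffel_base_contract[OF y]) (simp add: n power2_eq_square)
  have q2: "(\<Sum>m\<in>UNIV. christoffel G (Inl i) (Inl j) (Inl m) y * christoffel G (Inl m) (Inl i) (Inl j) y)
      = ?P\<^sup>2 * ((\<alpha> $ j)\<^sup>2 - \<epsilon> $ j * (\<epsilon> $ i * (\<alpha> $ i)\<^sup>2) + (if i = j then 2 * (\<alpha> $ j)\<^sup>2 else 0))" for i
  proof (cases "i = j")
    case True
    have "(\<Sum>m\<in>UNIV. \<epsilon> $ m * \<alpha> $ m * (- ?P * \<alpha> $ m)) = 0" by (rule n)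
    with True show ?thesis
      by (subst christoffel_base_contract[OF y])
        (simp add: christoffel_base_trace[OF y] power2_eq_square sign_sq)
  next
    case False
    then show ?thesis
      by (subst christoffel_base_contract[OF y])
        (simp add: christoffel_G[OF y] algebra_simps power2_eq_square)
  qed
  have base: "riemann G (Inl i) (Inl j) (Inl i) (Inl j) y
      = (?P' + ?P\<^sup>2) * (\<alpha> $ j)\<^sup>2 + (?P' + ?P\<^sup>2) * (\<epsilon> $ j * (\<epsilon> $ i * (\<alpha> $ i)\<^sup>2))
        - (if i = j then 2 * (?P' + ?P\<^sup>2) * (\<alpha> $ j)\<^sup>2 else 0)" for i
    using q1[of "- ?P"] q2[of i]
    by (simp add: riemann_def sum_UNIV_Plus pdrv_christoffel_G[OF y] christoffel_G(2-)[OF y]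
        christoffel_base_trace[OF y] sum_subtractf sign_sq)
      (simp add: algebra_simps power2_eq_square sign_sq)
  have fibre: "riemann G (Inr c) (Inl j) (Inr c) (Inl j) y
      = (- ?Q' - 2 * ?P * ?Q - ?Q\<^sup>2) * (\<alpha> $ j)\<^sup>2" for c
    using q1[of "?Q"]
    by (simp add: riemann_def sum_UNIV_Plus pdrv_christoffel_G[OF y] christoffel_G(2-)[OF y]
        sum_subtractf mult_delta_left mult_delta_right)
      (simp add: algebra_simps power2_eq_square)
  have z: "(\<Sum>i\<in>UNIV. (?P' + ?P\<^sup>2) * (\<epsilon> $ j * (\<epsilon> $ i * (\<alpha> $ i)\<^sup>2))) = 0"
    by (rule null_sumI[of _ "(?P' + ?P\<^sup>2) * \<epsilon> $ j"]) simp
  show "ricci G (Inl j) (Inl j) y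
      = ((?n - 2) * (?P' + ?P\<^sup>2) - ?d * (?Q' + 2 * ?P * ?Q + ?Q\<^sup>2)) * (\<alpha> $ j)\<^sup>2"
    unfolding ricci_def sum_UNIV_Plus base fibre sum.distrib sum_subtractf z
    by (simp add: algebra_simps)
qed

text \<open>
  For a general warped product the correction is \<open>g\<^sub>F\<close> times a combination of \<open>f \<Delta>f\<close> and \<open>|\<nabla>f|\<^sup>2\<close>;
  both vanish for a function of a null coordinate.
\<close>

lemma ricci_fibre:
  assumes y: "y \<in> D"
  shows "ricci G (Inr a) (Inr b) y = ricci H a b (fibre_part y)"
proof -
  let ?P = "P (\<xi> y)" and ?Q = "Q (\<xi> y)" and ?K = "K (\<xi> y)" and ?H = "H (fibre_part y)"
  have n: "(\<Sum>m\<in>UNIV. s * \<alpha> $ m * (t * \<epsilon> $ m * \<alpha> $ m * u)) = 0" for s t u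
    by (rule null_sumI[of _ "s * t * u"]) (simp add: power2_eq_square)
  have base: "riemann G (Inl i) (Inr b) (Inl i) (Inr a) y
      = (?K * ?Q - deriv K (\<xi> y)) * ?H $ a $ b * (\<epsilon> $ i * (\<alpha> $ i)\<^sup>2)" for i
    using n[of "- ?P" "- ?K" "?H $ a $ b"]
    by (simp add: riemann_def sum_UNIV_Plus pdrv_christoffel_G[OF y] christoffel_G(2-)[OF y]
        christoffel_base_trace[OF y] mult_delta_right sum_negf)
      (simp add: algebra_simps power2_eq_square)
  have fibre: "riemann G (Inr c) (Inr b) (Inr c) (Inr a) y = riemann H c b c a (fibre_part y)" for c
    using n[of ?Q "- ?K" "?H $ a $ b"] n[of ?Q "- ?K" "?H $ c $ b"]
    by (simp add: riemann_def sum_UNIV_Plus pdrv_christoffel_G[OF y] christoffel_G(2-)[OF y]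
        sum_subtractf) (cases "a = c"; simp)
  show ?thesis
    unfolding ricci_def sum_UNIV_Plus fibre
    using null_sumI[OF base] by simp
qed

lemma scalar_curv_G:
  assumes y: "y \<in> D"
  shows "scalar_curv G y = scalar_curv H (fibre_part y) / (f (\<xi> y))\<^sup>2"
proof -
  obtain C where C: "\<And>j. ricci G (Inl j) (Inl j) y = C * (\<alpha> $ j)\<^sup>2"
    using ricci_base[OF y] by blast
  have "(\<Sum>j\<in>UNIV. \<epsilon> $ j * (\<phi> (\<xi> y))\<^sup>2 * (C * (\<alpha> $ j)\<^sup>2)) = 0"
    by (rule null_sumI[of _ "(\<phi> (\<xi> y))\<^sup>2 * C"]) simp
  then show ?thesis
    by (simp add: scalar_curv_def sum_UNIV_Plus matrix_inv_G[OF y] C ricci_fibre[OF y]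
        mult_delta_left sum_divide_distrib)
qed

text \<open>
  The Christoffel term adds a multiple of \<open>\<alpha> \<otimes> \<alpha>\<close> to \<open>h'' \<alpha> \<otimes> \<alpha>\<close>; its part proportional to \<open>\<delta>\<close>
  has the factor \<open>|d\<xi>|\<^sup>2 = 0\<close>.
\<close>

lemma hessian_base:
  assumes y: "y \<in> D" and h: "smooth_on I h" and u: "\<And>y. y \<in> D \<Longrightarrow> u y = h (\<xi> y)"
  obtains C where "\<And>i. hessian G u (Inl i) (Inl i) y = C * (\<alpha> $ i)\<^sup>2"
proof
  fix i
  note d = smooth_on_real_derivs[OF h open_I D_parts(1)]
  have u1: "pdrv (Inl j) u y = deriv h (\<xi> y) * \<alpha> $ j" if "y \<in> D" for y j
    using pdrv_base_fun(1)[OF that u d(1)[OF that]] by simp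
  have u2: "pdrv (Inl i) (pdrv (Inl i) u) y = deriv (deriv h) (\<xi> y) * (\<alpha> $ i)\<^sup>2"
    by (subst pdrv_base[where r = "deriv h" and k = "\<lambda>_. \<alpha> $ i", OF y u1 d(2)[OF y]])
      (simp_all add: power2_eq_square)
  have n: "(\<Sum>m\<in>UNIV. \<epsilon> $ m * \<alpha> $ m * (c * \<alpha> $ m)) = 0" for c
    by (rule null_sumI[of _ c]) (simp add: power2_eq_square)
  have "(\<Sum>k\<in>UNIV. (deriv h (\<xi> y) * \<alpha> $ k) * christoffel G (Inl k) (Inl i) (Inl i) y)
      = - 2 * P (\<xi> y) * deriv h (\<xi> y) * (\<alpha> $ i)\<^sup>2"
    by (subst christoffel_base_contract[OF y]) (simp add: n power2_eq_square)
  then show "hessian G u (Inl i) (Inl i) y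
      = (deriv (deriv h) (\<xi> y) + 2 * P (\<xi> y) * deriv h (\<xi> y)) * (\<alpha> $ i)\<^sup>2"
    by (simp add: hessian_def sum_UNIV_Plus u1[OF y] u2 christoffel_G(5)[OF y] algebra_simps)
qed

text \<open>
  Multiplying the \<open>i\<close>-th diagonal equation by \<open>\<epsilon>\<^sub>i\<close> makes its left side independent of \<open>i\<close>, and the
  right sides add up to zero.
\<close>

lemma soliton_scalar_curv:
  assumes y: "y \<in> D" and h: "smooth_on I h" and u: "\<And>y. y \<in> D \<Longrightarrow> u y = h (\<xi> y)"
    and eq: "\<And>i. (S - \<rho>) * G y $ Inl i $ Inl i = hessian G u (Inl i) (Inl i) y"
  shows "S = \<rho>"
proof -
  obtain C where C: "\<And>i. hessian G u (Inl i) (Inl i) y = C * (\<alpha> $ i)\<^sup>2"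
    using hessian_base[OF y h u] by blast
  have "(S - \<rho>) / (\<phi> (\<xi> y))\<^sup>2 = C * (\<epsilon> $ i * (\<alpha> $ i)\<^sup>2)" for i
  proof -
    have "\<epsilon> $ i * ((S - \<rho>) * (\<epsilon> $ i / (\<phi> (\<xi> y))\<^sup>2)) = \<epsilon> $ i * (C * (\<alpha> $ i)\<^sup>2)"
      using eq[of i] by (simp add: C G_base[OF y])
    moreover have "\<epsilon> $ i * ((S - \<rho>) * (\<epsilon> $ i / (\<phi> (\<xi> y))\<^sup>2)) = (\<epsilon> $ i * \<epsilon> $ i) * ((S - \<rho>) / (\<phi> (\<xi> y))\<^sup>2)"
      by simp
    ultimately show ?thesis by (simp add: sign_sq mult.left_commute)
  qed
  then have "(\<Sum>i\<in>(UNIV::'n set). (S - \<rho>) / (\<phi> (\<xi> y))\<^sup>2) = 0" by (rule null_sumI)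
  then show ?thesis using pos(1)[OF y] by simp
qed

end

section \<open>Charts of the warped product\<close>

lemma warped_coord_parts:
  "base_part (coord (invariant_warped_manifold \<epsilon> \<alpha> I \<phi> f F) c (x, p)) = x"
  "fibre_part (coord (invariant_warped_manifold \<epsilon> \<alpha> I \<phi> f F) c (x, p)) = coord F c p"
  by (simp_all add: invariant_warped_manifold_def warped_manifold_def base_part_def fibre_part_def)

lemma in_chart_warped:
  assumes inj: "inj_on (coord F c) (cdom F c)"
    and y: "linear_form \<alpha> (base_part y) \<in> I" "fibre_part y \<in> coord F c ` cdom F c"
  shows "in_chart (invariant_warped_manifold \<epsilon> \<alpha> I \<phi> f F) c w y
    = w (base_part y, inv_into (cdom F c) (coord F c) (fibre_part y))"
proof -
  let ?M = "invariant_warped_manifold \<epsilon> \<alpha> I \<phi> f F"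
  let ?q = "inv_into (cdom F c) (coord F c) (fibre_part y)"
  have q: "?q \<in> cdom F c" "coord F c ?q = fibre_part y"
    using y(2) by (auto simp: inv_into_into f_inv_into_f)
  have dom: "cdom ?M c = linear_form \<alpha> -` I \<times> cdom F c"
    by (simp add: invariant_warped_manifold_def warped_manifold_def)
  have "inj_on (coord ?M c) (cdom ?M c)"
  proof (rule inj_onI)
    fix s t assume st: "s \<in> cdom ?M c" "t \<in> cdom ?M c" "coord ?M c s = coord ?M c t"
    have "fst s = fst t" "coord F c (snd s) = coord F c (snd t)"
      using st(3) warped_coord_parts by (metis prod.collapse)+
    moreover have "snd s \<in> cdom F c" "snd t \<in> cdom F c" using st(1,2) by (auto simp: dom)
    ultimately show "s = t" using inj_onD[OF inj] prod_eqI by metis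
  qed
  moreover have "coord ?M c (base_part y, ?q) = y"
  proof -
    have "coord ?M c (base_part y, ?q) $ k = y $ k" for k
      using warped_coord_parts[of \<epsilon> \<alpha> I \<phi> f F c "base_part y" ?q] q(2)
      by (cases k) (simp_all add: base_part_def fibre_part_def vec_eq_iff)
    then show ?thesis unfolding vec_eq_iff by blast
  qed
  moreover have "(base_part y, ?q) \<in> cdom ?M c" using y(1) q(1) by (simp add: dom)
  ultimately have "inv_into (cdom ?M c) (coord ?M c) y = (base_part y, ?q)"
    by (intro inv_into_f_eq)
  then show ?thesis by (simp only: in_chart_def comp_apply)
qed

text \<open>
  Both evaluations of \<open>S\<^sub>g\<close> are made at one point with \<open>\<xi> = t\<close>; as \<open>t\<close> is arbitrary in \<open>I\<close>, a
  nonzero \<open>\<lambda>\<^sub>F\<close> even forces \<open>f\<close> to be constant.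
\<close>

lemma null_warped_soliton_constant:
  fixes \<epsilon> \<alpha> :: "real^'n::finite" and F :: "('p, 'c, 'd::finite) metric_manifold"
    and I :: "real set"
  assumes sign: "\<And>i. \<epsilon> $ i = 1 \<or> \<epsilon> $ i = -1"
    and F: "semi_riemannian_manifold F" "constant_scalar_curvature F lamF"
    and "\<alpha> \<noteq> 0" and null: "(\<Sum>i\<in>UNIV. \<epsilon> $ i * (\<alpha> $ i)\<^sup>2) = 0"
    and I: "open I" "t \<in> I"
    and \<phi>: "smooth_positive_on I \<phi>" and f: "smooth_positive_on I f" and h: "smooth_on I h"
    and soliton: "gradient_yamabe_soliton (invariant_warped_manifold \<epsilon> \<alpha> I \<phi> f F)
      (h \<circ> linear_form \<alpha> \<circ> fst) \<rho>"
  shows "\<rho> = lamF / (f t)\<^sup>2"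
proof -
  let ?M = "invariant_warped_manifold \<epsilon> \<alpha> I \<phi> f F"
  let ?u = "h \<circ> linear_form \<alpha> \<circ> fst"
  have man: "smooth_manifold F" using F(1) by (simp add: semi_riemannian_manifold_def)
  then obtain c p where c: "c \<in> charts F" and p: "p \<in> cdom F c"
    unfolding smooth_manifold_def by blast
  have inj: "inj_on (coord F c) (cdom F c)"
  proof -
    have "openin (ptop F) (cdom F c)" "homeomorphic_map (subtopology (ptop F) (cdom F c))
        (top_of_set (coord F c ` cdom F c)) (coord F c)"
      using man c by (auto simp: smooth_manifold_def)
    then show ?thesis
      by (metis homeomorphic_imp_injective_map openin_subset topspace_subtopology_subset)
  qed
  define V where "V = coord F c ` cdom F c"
  define H where "H = in_chart F c (gmat F c)"
  define G where "G = in_chart ?M c (gmat ?M c)"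
  have HV: "\<exists>q\<in>cdom F c. H z = gmat F c q" if "z \<in> V" for z
    using that by (auto simp: V_def H_def in_chart_def inv_into_into)
  have G: "G y = gmat ?M c (base_part y, inv_into (cdom F c) (coord F c) (fibre_part y))"
    if "linear_form \<alpha> (base_part y) \<in> I" "fibre_part y \<in> V" for y
    unfolding G_def by (rule in_chart_warped[OF inj]) (use that V_def in auto)
  interpret null_warped \<epsilon> \<alpha> I \<phi> f V H G "\<lambda>y. linear_form \<alpha> (base_part y)"
      "{y. linear_form \<alpha> (base_part y) \<in> I \<and> fibre_part y \<in> V}"
  proof -
    show "null_warped \<epsilon> \<alpha> I \<phi> f V H G"
    proof
      show "open V" using man c by (auto simp: V_def smooth_manifold_def)
      show "\<epsilon> $ i * \<epsilon> $ i = 1" for i using sign[of i] by auto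
      fix z assume z: "z \<in> V"
      then obtain q where q: "q \<in> cdom F c" "H z = gmat F c q" using HV by blast
      have "transpose (gmat F c q) = gmat F c q \<and> det (gmat F c q) \<noteq> 0"
        using F(1) c q(1) unfolding semi_riemannian_manifold_def by blast
      then have tr: "transpose (H z) = H z" and det: "det (H z) \<noteq> 0"
        using q(2) by simp_all
      show "H z $ i $ j = H z $ j $ i" for i j
        using arg_cong[OF tr, of "\<lambda>A. A $ i $ j"] by (simp add: transpose_def)
      obtain B where "H z ** B = mat 1" using det invertible_det_nz invertible_def by metis
      then show "H z ** matrix_inv (H z) = mat 1" using matrix_inv_eqI by metis
      have "smooth_on (coord F c ` cdom F c) (in_chart F c (\<lambda>p. gmat F c p $ i $ j))" for i j
        using F(1) c unfolding semi_riemannian_manifold_def by blast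
      then have "smooth_on V (\<lambda>z. H z $ i $ j)" for i j
        by (simp add: V_def H_def in_chart_def o_def)
      then have "foldr dderiv [] (\<lambda>z. H z $ i $ j) differentiable_on V" for i j
        unfolding smooth_on_def by (metis empty_set empty_subsetI)
      then show "(\<lambda>z. H z $ i $ j) differentiable (at z)" for i j
        using z \<open>open V\<close> by (simp add: differentiable_on_eq_differentiable_at)
    qed (use null I \<phi> f in \<open>auto simp: G invariant_warped_manifold_def warped_manifold_def
        H_def in_chart_def\<close>)
  qed simp_all
  \<comment> \<open>\<open>\<alpha>\<close> is null for \<open>\<delta>\<close> but not for the Euclidean inner product, so \<open>\<xi>\<close> takes the value \<open>t\<close>
    on its line.\<close>
  define x where "x = (t / (\<alpha> \<bullet> \<alpha>)) *\<^sub>R \<alpha>"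
  have x: "linear_form \<alpha> x = t"
  proof -
    have "linear_form \<alpha> x = \<alpha> \<bullet> x" by (simp add: linear_form_def inner_vec_def)
    then show ?thesis using \<open>\<alpha> \<noteq> 0\<close> by (simp add: x_def)
  qed
  define y where "y = coord ?M c (x, p)"
  have y: "base_part y = x" "fibre_part y = coord F c p"
    unfolding y_def by (rule warped_coord_parts)+
  have yD: "y \<in> {y. linear_form \<alpha> (base_part y) \<in> I \<and> fibre_part y \<in> V}"
    using p I by (simp add: y x V_def)
  have Gp: "G y = gmat ?M c (x, p)"
    using p inj yD by (subst G) (auto simp: y)
  have "c \<in> charts ?M" "(x, p) \<in> cdom ?M c"
    using c p x I by (auto simp: invariant_warped_manifold_def warped_manifold_def)
  then have "(scalar_curv G y - \<rho>) *\<^sub>R G y = Hess ?M ?u c (x, p)"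
    using soliton unfolding gradient_yamabe_soliton_def scalar_curvature_def Gp
    by (auto simp: G_def y_def)
  then have eq: "(scalar_curv G y - \<rho>) * G y $ i $ j = hessian G (in_chart ?M c ?u) i j y" for i j
    by (auto simp: vec_eq_iff Hess_def G_def y_def)
  have "scalar_curv G y = \<rho>"
    by (rule soliton_scalar_curv[OF yD h _ eq])
      (subst in_chart_warped[OF inj], auto simp: V_def)
  moreover have "scalar_curv G y = scalar_curv H (coord F c p) / (f t)\<^sup>2"
    using scalar_curv_G[OF yD] by (simp add: y x)
  moreover have "scalar_curv H (coord F c p) = lamF"
    using F(2) c p unfolding constant_scalar_curvature_def scalar_curvature_def H_def by auto
  ultimately show ?thesis by simp
qed

theorem corollary1p8:
  fixes \<epsilon> \<alpha> :: "real^'n"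
    and F :: "('p, 'c, 'd::finite) metric_manifold"
    and lamF :: real
    and a b :: ereal
  assumes "CARD('n) \<ge> 3"
    and "\<And>i. \<epsilon> $ i = 1 \<or> \<epsilon> $ i = -1"
    and "semi_riemannian_manifold F"
    and "constant_scalar_curvature F lamF"
    and "\<alpha> \<noteq> 0"
    and "a < b"
    and "(\<Sum>i\<in>UNIV. \<epsilon> $ i * (\<alpha> $ i)\<^sup>2) = 0"
  shows "(lamF > 0 \<longrightarrow>
          \<not> (\<exists>\<phi> f h. smooth_positive_on (einterval a b) \<phi> \<and> smooth_positive_on (einterval a b) f \<and>
                smooth_positive_on (einterval a b) h \<and>
                (expanding_soliton (invariant_warped_manifold \<epsilon> \<alpha> (einterval a b) \<phi> f F)
                   (h \<circ> linear_form \<alpha> \<circ> fst) \<or>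
                 steady_soliton (invariant_warped_manifold \<epsilon> \<alpha> (einterval a b) \<phi> f F)
                   (h \<circ> linear_form \<alpha> \<circ> fst)))) \<and>
         (lamF < 0 \<longrightarrow>
          \<not> (\<exists>\<phi> f h. smooth_positive_on (einterval a b) \<phi> \<and> smooth_positive_on (einterval a b) f \<and>
                smooth_positive_on (einterval a b) h \<and>
                (shrinking_soliton (invariant_warped_manifold \<epsilon> \<alpha> (einterval a b) \<phi> f F)
                   (h \<circ> linear_form \<alpha> \<circ> fst) \<or>
                 steady_soliton (invariant_warped_manifold \<epsilon> \<alpha> (einterval a b) \<phi> f F)
                   (h \<circ> linear_form \<alpha> \<circ> fst))))"
proof -
  obtain t where t: "t \<in> einterval a b" using einterval_nonempty[OF \<open>a < b\<close>] by blast
  have sign: "sgn \<rho> = sgn lamF"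
    if "smooth_positive_on (einterval a b) \<phi>" "smooth_positive_on (einterval a b) f"
      "smooth_positive_on (einterval a b) h"
      "gradient_yamabe_soliton (invariant_warped_manifold \<epsilon> \<alpha> (einterval a b) \<phi> f F)
        (h \<circ> linear_form \<alpha> \<circ> fst) \<rho>" for \<phi> f h \<rho>
  proof -
    have "\<rho> = lamF / (f t)\<^sup>2"
      using null_warped_soliton_constant[OF assms(2-5,7) open_einterval t that(1,2) _ that(4)] that(3)
      by (simp add: smooth_positive_on_def)
    moreover have "0 < f t" using that(2) t by (auto simp: smooth_positive_on_def)
    ultimately show ?thesis by (simp add: sgn_divide)
  qed
  show ?thesis
    unfolding expanding_soliton_def steady_soliton_def shrinking_soliton_def
    using sign by (metis less_asym less_irrefl sgn_greater sgn_less sgn_0)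
qed

end
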